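(* Let $\mathbf{k}$ be a field, let $F$ be a sheaf on a finite poset $\Pi$, and fix a signed incidence relation $[\,\cdot:\cdot\,]$ on the order complex $K(\Pi)$. For $j\ge0$ let $$I^j:=\bigoplus_{\pi_\bullet\in K^j(\Pi)}[\pi_0]^{F(\pi_j)},$$ let $\eta^j:I^j\to I^{j+1}$ be the natural transformation which on the $\pi_\bullet$-summand $[\pi_0]^{F(\pi_j)}$ is $$\eta^j\big|_{[\pi_0]^{F(\pi_j)}}=\sum_{\pi_\bullet<_1\tau_\bullet}[\pi_\bullet:\tau_\bullet]\,F(\pi_j\le\tau_{j+1}),$$ where the term for $\tau_\bullet=(\tau_0<\cdots<\tau_{j+1})$ is regarded as a natural transformation into the $\tau_\bullet$-summand $[\tau_0]^{F(\tau_{j+1})}$ of $I^{j+1}$, and let $\alpha:F\to I^0$ be the natural transformation given by $$\alpha(\sigma):=\sum_{\sigma\le\gamma}F(\sigma\le\gamma):F(\sigma)\to\bigoplus_{\sigma\le\gamma}F(\gamma)=I^0(\sigma).$$ Then $0\to F\xrightarrow{\alpha}I^0\xrightarrow{\eta^0}I^1\xrightarrow{\eta^1}\cdots$ is an injective resolution of $F$.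
   Context: A sheaf $F$ on a finite poset $\Pi$ assigns to each $\pi\in\Pi$ a finite-dimensional $\mathbf{k}$-vector space $F(\pi)$ and to each relation $\tau\le\gamma$ a linear map $F(\tau\le\gamma):F(\tau)\to F(\gamma)$, with $F(\tau\le\tau)=\mathrm{id}$ and $F(\tau\le\gamma)\circ F(\sigma\le\tau)=F(\sigma\le\gamma)$. A natural transformation $\eta:F\to G$ is a collection of linear maps $\eta(\pi):F(\pi)\to G(\pi)$ commuting with the sheaf maps; it is injective if every $\eta(\pi)$ is injective; kernels and images are pointwise. A sheaf $I$ is injective if for each injective natural transformation $A\hookrightarrow B$, every natural transformation $A\to I$ extends to $B\to I$. An injective resolution of $F$ is an exact sequence $0\to F\to I^0\to I^1\to\cdots$ with each $I^j$ injective. For $\pi\in\Pi$ and a finite-dimensional vector space $V$, $[\pi]^V$ is the sheaf with $[\pi]^V(\gamma)=V$ if $\gamma\le\pi$ and $0$ otherwise, and $[\pi]^V(\gamma\le\tau)=\mathrm{id}_V$ if $\gamma\le\tau\le\pi$ and $0$ otherwise. For $\sigma\le\pi$ there is an identification $\mathrm{Hom}(V,W)\cong\mathrm{Hom}([\pi]^V,[\sigma]^W)$: a linear map $f:V\to W$ corresponds to the natural transformation equal to $f$ at each $\gamma\le\sigma$ and to $0$ at all other elements. The order complex $K(\Pi)$ is the poset (an abstract simplicial complex, ordered by inclusion) of strictly increasing chains $\pi_\bullet=(\pi_0<\pi_1<\cdots<\pi_j)$ in $\Pi$, $j\ge 0$; $K^j(\Pi)$ is the set of $j$-simplices, i.e.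 chains with $j+1$ elements. We write $\pi_\bullet<_1\tau_\bullet$ if $\pi_\bullet$ is obtained from $\tau_\bullet$ by removing exactly one element; then $\tau_0\le\pi_0$ and, for $\pi_\bullet\in K^j(\Pi)$, $\pi_j\le\tau_{j+1}$. A signed incidence relation on $K(\Pi)$ is an assignment to each pair of simplices $\sigma_\bullet,\gamma_\bullet\in K(\Pi)$ of a number $[\sigma_\bullet:\gamma_\bullet]\in\{-1,0,1\}$ such that (1) if $[\sigma_\bullet:\gamma_\bullet]\ne0$, then $\sigma_\bullet<_1\gamma_\bullet$; and (2) for each pair of simplices $(\sigma_\bullet,\gamma_\bullet)$, $\sum_{\tau_\bullet\in K(\Pi)}[\sigma_\bullet:\tau_\bullet][\tau_\bullet:\gamma_\bullet]=0$.
   Formalization: The signed incidence relation is also assumed to be nonzero on every pair σ <_1 τ, with [x:(x<y)]+[y:(x<y)]=0 in k for each edge; without this the claim fails, e.g. for the zero relation on {a<b} with F constant. *)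

theory Defs
  imports Complex_Main "HOL-Library.Function_Algebras"
begin

section \<open>Sheaves of finite-dimensional vector spaces on a finite poset\<close>

text \<open>
  A sheaf on a poset \<open>P\<close> (a set in a partially ordered type) has as stalks subspaces of one
  ambient vector space, a type \<open>'v\<close> with scalar multiplication \<open>s\<close>.  This loses nothing: any
  family of vector spaces indexed by \<open>P\<close> embeds into its direct sum.  The restriction maps are
  total functions of which only the values on the stalks matter.
\<close>

record ('p, 'v) sheaf_data =
  stalk :: "'p \<Rightarrow> 'v set"
  res :: "'p \<Rightarrow> 'p \<Rightarrow> 'v \<Rightarrow> 'v"

definition finite_dim_subspace ::
  "('k::field \<Rightarrow> 'v::ab_group_add \<Rightarrow> 'v) \<Rightarrow> 'v set \<Rightarrow> bool" where
  "finite_dim_subspace s V \<longleftrightarrow>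
     module.subspace s V \<and> (\<exists>B. finite B \<and> B \<subseteq> V \<and> module.span s B = V)"

definition linear_map_on ::
  "('k::field \<Rightarrow> 'v::ab_group_add \<Rightarrow> 'v) \<Rightarrow> ('k \<Rightarrow> 'w::ab_group_add \<Rightarrow> 'w) \<Rightarrow>
   'v set \<Rightarrow> 'w set \<Rightarrow> ('v \<Rightarrow> 'w) \<Rightarrow> bool" where
  "linear_map_on s t V W f \<longleftrightarrow>
     (\<forall>x\<in>V. f x \<in> W) \<and>
     (\<forall>x\<in>V. \<forall>y\<in>V. f (x + y) = f x + f y) \<and>
     (\<forall>c. \<forall>x\<in>V. f (s c x) = t c (f x))"

definition sheaf ::
  "('k::field \<Rightarrow> 'v::ab_group_add \<Rightarrow> 'v) \<Rightarrow> 'p::order set \<Rightarrow> ('p, 'v) sheaf_data \<Rightarrow> bool" where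
  "sheaf s P F \<longleftrightarrow>
     vector_space s \<and>
     (\<forall>\<pi>\<in>P. finite_dim_subspace s (stalk F \<pi>)) \<and>
     (\<forall>\<sigma>\<in>P. \<forall>\<tau>\<in>P. \<sigma> \<le> \<tau> \<longrightarrow>
        linear_map_on s s (stalk F \<sigma>) (stalk F \<tau>) (res F \<sigma> \<tau>)) \<and>
     (\<forall>\<pi>\<in>P. \<forall>x\<in>stalk F \<pi>. res F \<pi> \<pi> x = x) \<and>
     (\<forall>\<sigma>\<in>P. \<forall>\<tau>\<in>P. \<forall>\<gamma>\<in>P. \<sigma> \<le> \<tau> \<longrightarrow> \<tau> \<le> \<gamma> \<longrightarrow>
        (\<forall>x\<in>stalk F \<sigma>. res F \<tau> \<gamma> (res F \<sigma> \<tau> x) = res F \<sigma> \<gamma> x))"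

definition nat_trans ::
  "('k::field \<Rightarrow> 'v::ab_group_add \<Rightarrow> 'v) \<Rightarrow> ('k \<Rightarrow> 'w::ab_group_add \<Rightarrow> 'w) \<Rightarrow> 'p::order set \<Rightarrow>
   ('p, 'v) sheaf_data \<Rightarrow> ('p, 'w) sheaf_data \<Rightarrow> ('p \<Rightarrow> 'v \<Rightarrow> 'w) \<Rightarrow> bool" where
  "nat_trans s t P F G \<eta> \<longleftrightarrow>
     (\<forall>\<pi>\<in>P. linear_map_on s t (stalk F \<pi>) (stalk G \<pi>) (\<eta> \<pi>)) \<and>
     (\<forall>\<sigma>\<in>P. \<forall>\<tau>\<in>P. \<sigma> \<le> \<tau> \<longrightarrow>
        (\<forall>x\<in>stalk F \<sigma>. \<eta> \<tau> (res F \<sigma> \<tau> x) = res G \<sigma> \<tau> (\<eta> \<sigma> x)))"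

definition injective_nat_trans ::
  "'p set \<Rightarrow> ('p, 'v) sheaf_data \<Rightarrow> ('p \<Rightarrow> 'v \<Rightarrow> 'w) \<Rightarrow> bool" where
  "injective_nat_trans P F \<eta> \<longleftrightarrow> (\<forall>\<pi>\<in>P. inj_on (\<eta> \<pi>) (stalk F \<pi>))"

definition kernel_at ::
  "('p, 'v) sheaf_data \<Rightarrow> ('p \<Rightarrow> 'v \<Rightarrow> 'w::zero) \<Rightarrow> 'p \<Rightarrow> 'v set" where
  "kernel_at F \<eta> \<pi> = {x \<in> stalk F \<pi>. \<eta> \<pi> x = 0}"

definition image_at ::
  "('p, 'v) sheaf_data \<Rightarrow> ('p \<Rightarrow> 'v \<Rightarrow> 'w) \<Rightarrow> 'p \<Rightarrow> 'w set" where
  "image_at F \<eta> \<pi> = \<eta> \<pi> ` stalk F \<pi>"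

text \<open>
  HOL cannot quantify over types inside a formula, so the types \<open>'a\<close>, \<open>'b\<close> of the ambient spaces
  of the test sheaves \<open>A \<hookrightarrow> B\<close> are parameters.  A statement in which they are type variables
  speaks about test sheaves in arbitrary vector spaces.
\<close>

definition injective_sheaf ::
  "'a::ab_group_add itself \<Rightarrow> 'b::ab_group_add itself \<Rightarrow>
   ('k::field \<Rightarrow> 'v::ab_group_add \<Rightarrow> 'v) \<Rightarrow> 'p::order set \<Rightarrow> ('p, 'v) sheaf_data \<Rightarrow> bool" where
  "injective_sheaf TA TB s P I \<longleftrightarrow>
     sheaf s P I \<and>
     (\<forall>(sA :: 'k \<Rightarrow> 'a \<Rightarrow> 'a) (sB :: 'k \<Rightarrow> 'b \<Rightarrow> 'b) A B \<iota> \<phi>.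
        sheaf sA P A \<longrightarrow> sheaf sB P B \<longrightarrow>
        nat_trans sA sB P A B \<iota> \<longrightarrow> injective_nat_trans P A \<iota> \<longrightarrow>
        nat_trans sA s P A I \<phi> \<longrightarrow>
        (\<exists>\<psi>. nat_trans sB s P B I \<psi> \<and>
             (\<forall>\<pi>\<in>P. \<forall>x\<in>stalk A \<pi>. \<psi> \<pi> (\<iota> \<pi> x) = \<phi> \<pi> x)))"

definition injective_resolution ::
  "'a::ab_group_add itself \<Rightarrow> 'b::ab_group_add itself \<Rightarrow>
   ('k::field \<Rightarrow> 'v::ab_group_add \<Rightarrow> 'v) \<Rightarrow> ('k \<Rightarrow> 'w::ab_group_add \<Rightarrow> 'w) \<Rightarrow> 'p::order set \<Rightarrow>
   ('p, 'v) sheaf_data \<Rightarrow> ('p \<Rightarrow> 'v \<Rightarrow> 'w) \<Rightarrow>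
   (nat \<Rightarrow> ('p, 'w) sheaf_data) \<Rightarrow> (nat \<Rightarrow> 'p \<Rightarrow> 'w \<Rightarrow> 'w) \<Rightarrow> bool" where
  "injective_resolution TA TB s t P F \<alpha> I \<eta> \<longleftrightarrow>
     sheaf s P F \<and>
     (\<forall>j. injective_sheaf TA TB t P (I j)) \<and>
     nat_trans s t P F (I 0) \<alpha> \<and>
     (\<forall>j. nat_trans t t P (I j) (I (Suc j)) (\<eta> j)) \<and>
     (\<forall>\<pi>\<in>P. kernel_at F \<alpha> \<pi> = {0}) \<and>
     (\<forall>\<pi>\<in>P. kernel_at (I 0) (\<eta> 0) \<pi> = image_at F \<alpha> \<pi>) \<and>
     (\<forall>j. \<forall>\<pi>\<in>P. kernel_at (I (Suc j)) (\<eta> (Suc j)) \<pi> = image_at (I j) (\<eta> j) \<pi>)"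


section \<open>The sheaves \<open>[\<pi>]\<^sup>V\<close> and direct sums\<close>

definition elementary_sheaf :: "'p::order \<Rightarrow> 'v::zero set \<Rightarrow> ('p, 'v) sheaf_data" where
  "elementary_sheaf \<pi> V =
     \<lparr> stalk = (\<lambda>\<gamma>. if \<gamma> \<le> \<pi> then V else {0}),
       res = (\<lambda>\<gamma> \<tau> x. if \<gamma> \<le> \<tau> \<and> \<tau> \<le> \<pi> then x else 0) \<rparr>"

text \<open>
  The natural transformation from \<open>[\<pi>]\<^sup>V\<close> to \<open>[\<sigma>]\<^sup>W\<close> given by \<open>f : V \<rightarrow> W\<close>, for \<open>\<sigma> \<le> \<pi>\<close>.
\<close>

definition elementary_hom :: "'p::order \<Rightarrow> ('v \<Rightarrow> 'w::zero) \<Rightarrow> 'p \<Rightarrow> 'v \<Rightarrow> 'w" where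
  "elementary_hom \<sigma> f \<gamma> x = (if \<gamma> \<le> \<sigma> then f x else 0)"

text \<open>
  The direct sum of a family \<open>G\<close> of sheaves over a finite index set \<open>J\<close>: elements of the stalks are
  functions on the index type that vanish outside \<open>J\<close>.  Sums of such functions are pointwise.
\<close>

definition pointwise_scale :: "('k \<Rightarrow> 'v \<Rightarrow> 'v) \<Rightarrow> 'k \<Rightarrow> ('i \<Rightarrow> 'v) \<Rightarrow> 'i \<Rightarrow> 'v" where
  "pointwise_scale s c x = (\<lambda>i. s c (x i))"

definition direct_sum :: "'i set \<Rightarrow> ('i \<Rightarrow> ('p, 'v::zero) sheaf_data) \<Rightarrow> ('p, 'i \<Rightarrow> 'v) sheaf_data"
  where
  "direct_sum J G =
     \<lparr> stalk = (\<lambda>\<gamma>. {x. (\<forall>i\<in>J. x i \<in> stalk (G i) \<gamma>) \<and> (\<forall>i. i \<notin> J \<longrightarrow> x i = 0)}),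
       res = (\<lambda>\<gamma> \<tau> x i. if i \<in> J then res (G i) \<gamma> \<tau> (x i) else 0) \<rparr>"

definition summand_incl :: "'i \<Rightarrow> 'v::zero \<Rightarrow> 'i \<Rightarrow> 'v" where
  "summand_incl i v = (\<lambda>i'. if i' = i then v else 0)"


section \<open>The order complex\<close>

text \<open>
  A chain \<open>\<pi>\<^sub>0 < \<dots> < \<pi>\<^sub>j\<close> is a strictly increasing list: \<open>\<pi>\<^sub>0\<close> is its \<open>hd\<close>, \<open>\<pi>\<^sub>j\<close> its \<open>last\<close>.
\<close>

definition order_complex :: "'p::order set \<Rightarrow> 'p list set" where
  "order_complex P = {c. c \<noteq> [] \<and> set c \<subseteq> P \<and> sorted_wrt (<) c}"

definition simplices :: "'p::order set \<Rightarrow> nat \<Rightarrow> 'p list set" where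
  "simplices P j = {c \<in> order_complex P. length c = Suc j}"

definition facet :: "'p list \<Rightarrow> 'p list \<Rightarrow> bool"  (infix "<\<^sub>1" 50) where
  "\<sigma> <\<^sub>1 \<tau> \<longleftrightarrow> (\<exists>xs x ys. \<tau> = xs @ x # ys \<and> \<sigma> = xs @ ys)"

text \<open>
  These conditions alone admit the zero relation, and, when \<open>P\<close> has no chain of three elements,
  every choice of signs on the edges.  Two further requirements of the usual notion of incidence
  numbers are therefore separate predicates: every facet has a nonzero incidence number, and the
  two ends of an edge have opposite incidence numbers.  The latter is the vanishing of the sum in
  the definition for the empty simplex, whose incidence number with every vertex is 1; it is only
  required in the field of coefficients, so that it says nothing about signs in characteristic 2.
\<close>

definition signed_incidence_relation :: "'p::order set \<Rightarrow> ('p list \<Rightarrow> 'p list \<Rightarrow> int) \<Rightarrow> bool" where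
  "signed_incidence_relation P inc \<longleftrightarrow>
     (\<forall>\<sigma>\<in>order_complex P. \<forall>\<gamma>\<in>order_complex P. inc \<sigma> \<gamma> \<in> {-1, 0, 1}) \<and>
     (\<forall>\<sigma>\<in>order_complex P. \<forall>\<gamma>\<in>order_complex P. inc \<sigma> \<gamma> \<noteq> 0 \<longrightarrow> \<sigma> <\<^sub>1 \<gamma>) \<and>
     (\<forall>\<sigma>\<in>order_complex P. \<forall>\<gamma>\<in>order_complex P.
        (\<Sum>\<tau>\<in>order_complex P. inc \<sigma> \<tau> * inc \<tau> \<gamma>) = 0)"

definition nonzero_on_facets :: "'p::order set \<Rightarrow> ('p list \<Rightarrow> 'p list \<Rightarrow> int) \<Rightarrow> bool" where
  "nonzero_on_facets P inc \<longleftrightarrow>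
     (\<forall>\<sigma>\<in>order_complex P. \<forall>\<tau>\<in>order_complex P. \<sigma> <\<^sub>1 \<tau> \<longrightarrow> inc \<sigma> \<tau> \<noteq> 0)"

definition opposite_on_edges ::
  "'k::field itself \<Rightarrow> 'p::order set \<Rightarrow> ('p list \<Rightarrow> 'p list \<Rightarrow> int) \<Rightarrow> bool" where
  "opposite_on_edges TK P inc \<longleftrightarrow>
     (\<forall>x\<in>P. \<forall>y\<in>P. x < y \<longrightarrow> (of_int (inc [x] [x, y] + inc [y] [x, y]) :: 'k) = 0)"


section \<open>The complex\<close>

definition resolution_sheaf ::
  "'p::order set \<Rightarrow> ('p, 'v::zero) sheaf_data \<Rightarrow> nat \<Rightarrow> ('p, 'p list \<Rightarrow> 'v) sheaf_data" where
  "resolution_sheaf P F j =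
     direct_sum (simplices P j) (\<lambda>c. elementary_sheaf (hd c) (stalk F (last c)))"

definition resolution_map ::
  "('k::field \<Rightarrow> 'v::ab_group_add \<Rightarrow> 'v) \<Rightarrow> 'p::order set \<Rightarrow> ('p, 'v) sheaf_data \<Rightarrow>
   ('p list \<Rightarrow> 'p list \<Rightarrow> int) \<Rightarrow> nat \<Rightarrow> 'p \<Rightarrow> ('p list \<Rightarrow> 'v) \<Rightarrow> ('p list \<Rightarrow> 'v)" where
  "resolution_map s P F inc j \<gamma> x =
     (\<Sum>c\<in>simplices P j. \<Sum>d | d \<in> simplices P (Suc j) \<and> c <\<^sub>1 d.
        summand_incl d
          (s (of_int (inc c d)) (elementary_hom (hd d) (res F (last c) (last d)) \<gamma> (x c))))"

definition resolution_augmentation ::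
  "'p::order set \<Rightarrow> ('p, 'v::ab_group_add) sheaf_data \<Rightarrow> 'p \<Rightarrow> 'v \<Rightarrow> ('p list \<Rightarrow> 'v)" where
  "resolution_augmentation P F \<sigma> v =
     (\<Sum>\<gamma> | \<gamma> \<in> P \<and> \<sigma> \<le> \<gamma>. summand_incl [\<gamma>] (res F \<sigma> \<gamma> v))"

end

theory Submission
  imports Defs
begin

text \<open>
  Exactness is checked at each \<open>\<sigma>\<close>.  There the complex \<open>I\<^sup>0 \<rightarrow> I\<^sup>1 \<rightarrow> \<dots>\<close> consists of the simplicial
  cochains on the order complex of \<open>{\<tau>. \<sigma> \<le> \<tau>}\<close>, with the value on a chain taken in the stalk of
  \<open>F\<close> at its end.  Since \<open>\<sigma>\<close> is the least of these elements, the order complex is a cone with apex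
  \<open>\<sigma>\<close>, and prepending \<open>\<sigma>\<close> to a nonempty chain does not move its end.  The usual
  contraction of a cone, \<open>(h x)(c) = \<plusminus> x(\<sigma> # c)\<close> for chains \<open>c\<close> that start above \<open>\<sigma>\<close>, thus makes
  sense with coefficients in \<open>F\<close>, and it satisfies \<open>\<delta> h + h \<delta> = id\<close> in positive degrees
  (\<open>contracting_homotopy\<close>).  In degree 0 the chain \<open>c\<close> would be empty, and its place is taken by the
  augmentation: \<open>\<alpha>(x [\<sigma>]) + h \<delta> x = x\<close> (\<open>augmented_homotopy\<close>).  Hence cocycles are coboundaries; that
  coboundaries are cocycles is the usual cancellation in a double sum (\<open>resolution_map_twice\<close>,
  \<open>resolution_map_augmentation\<close>).

  The incidence numbers need not come from an ordering of the vertices.  All that the homotopy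
  uses is that they are signs on facets and that the four of them in a square formed by a facet \<open>c\<close>
  of \<open>d\<close> and the cones \<open>\<sigma> # c\<close> and \<open>\<sigma> # d\<close> have product \<open>-1\<close> (\<open>incidence_exchange\<close>), together with the
  analogous condition on edges, where \<open>c\<close> is empty.

  Injectivity of \<open>I\<^sup>j\<close> comes down to linear algebra: a natural transformation into \<open>[\<pi>]\<^sup>V\<close> is the same
  as a linear map from the stalk at \<open>\<pi>\<close> to \<open>V\<close>, and linear maps extend along injective linear maps
  (\<open>vector_space_injective\<close>, \<open>injective_elementary_sheaf\<close>, \<open>injective_direct_sum\<close>).
\<close>

section \<open>Extension of linear maps between subspaces\<close>

lemma linear_map_on_zero:
  fixes s :: "'k::field \<Rightarrow> 'v::ab_group_add \<Rightarrow> 'v" and t :: "'k \<Rightarrow> 'w::ab_group_add \<Rightarrow> 'w"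
  assumes "linear_map_on s t V W f" and "0 \<in> V"
  shows "f 0 = 0"
proof -
  have "f (0 + 0) = f 0 + f 0"
    using assms unfolding linear_map_on_def by blast
  then show ?thesis by simp
qed

lemma linear_map_on_sum:
  fixes s :: "'k::field \<Rightarrow> 'v::ab_group_add \<Rightarrow> 'v" and t :: "'k \<Rightarrow> 'w::ab_group_add \<Rightarrow> 'w"
  assumes s: "vector_space s" and V: "module.subspace s V" and f: "linear_map_on s t V W f"
    and g: "\<And>i. i \<in> J \<Longrightarrow> g i \<in> V"
  shows "f (\<Sum>i\<in>J. g i) = (\<Sum>i\<in>J. f (g i))"
proof -
  interpret vector_space s by (rule s)
  have f0: "f 0 = 0"
    using linear_map_on_zero[OF f subspace_0[OF V]] .
  show ?thesis
    using g
  proof (induction J rule: infinite_finite_induct)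
    case (insert i J)
    then have "g i \<in> V" "(\<Sum>i\<in>J. g i) \<in> V"
      by (auto intro: subspace_sum[OF V])
    then have "f (g i + (\<Sum>i\<in>J. g i)) = f (g i) + f (\<Sum>i\<in>J. g i)"
      using f unfolding linear_map_on_def by blast
    with insert show ?case by simp
  qed (simp_all add: f0)
qed

text \<open>
  A map that is linear only on a subspace says nothing about its other values.  Replacing it by an
  everywhere linear map, built from a basis of the subspace, makes the linear algebra of total maps
  applicable to stalks.
\<close>

lemma linear_map_on_extends_to_linear:
  fixes s :: "'k::field \<Rightarrow> 'v::ab_group_add \<Rightarrow> 'v" and t :: "'k \<Rightarrow> 'w::ab_group_add \<Rightarrow> 'w"
  assumes "vector_space s" and "vector_space t"
    and V: "module.subspace s V" and f: "linear_map_on s t V W f"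
  obtains g where "Vector_Spaces.linear s t g" and "\<And>x. x \<in> V \<Longrightarrow> g x = f x"
proof -
  interpret vector_space_pair s t
    using assms(1,2) by (simp add: vector_space_pair_def)
  obtain B where B: "B \<subseteq> V" "vs1.independent B" "V = vs1.span B"
    using vs1.maximal_independent_subset[of V] vs1.span_minimal[OF _ V] by (metis antisym_conv)
  define g where "g = construct B f"
  have lin: "Vector_Spaces.linear s t g"
    unfolding g_def by (rule linear_construct[OF B(2)])
  interpret g: Vector_Spaces.linear s t g by (rule lin)
  have "x \<in> V \<and> g x = f x" if "x \<in> vs1.span B" for x
    using that
  proof (induction rule: vs1.span_induct_alt)
    case base
    show ?case
      using linear_map_on_zero[OF f] vs1.subspace_0[OF V] by simp
  next
    case (step c x y)
    have "x \<in> V" "g x = f x"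
      using step(1) B(1) construct_basis[OF B(2)] by (auto simp: g_def)
    then have "f (s c x + y) = f (s c x) + f y" "f (s c x) = t c (f x)"
      using f step(2) vs1.subspace_scale[OF V] unfolding linear_map_on_def by blast+
    with \<open>x \<in> V\<close> \<open>g x = f x\<close> step(2) show ?case
      by (simp add: g.add g.scale vs1.subspace_add[OF V] vs1.subspace_scale[OF V])
  qed
  with lin B(3) that show thesis by blast
qed

text \<open>
  Vector spaces are injective objects: an injective linear map has a linear left inverse \<open>r\<close>, and
  \<open>\<phi> \<circ> r\<close> is the extension.  The left inverse takes all its values in \<open>V\<close>, so that the extension
  again lands in \<open>U\<close>.
\<close>

lemma vector_space_injective:
  fixes s :: "'k::field \<Rightarrow> 'v::ab_group_add \<Rightarrow> 'v" and t :: "'k \<Rightarrow> 'w::ab_group_add \<Rightarrow> 'w"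
    and u :: "'k \<Rightarrow> 'u::ab_group_add \<Rightarrow> 'u"
  assumes vs: "vector_space s" "vector_space t" "vector_space u"
    and V: "module.subspace s V"
    and \<iota>: "linear_map_on s t V W \<iota>" "inj_on \<iota> V"
    and \<phi>: "linear_map_on s u V U \<phi>"
  obtains \<psi> where "linear_map_on t u W U \<psi>" and "\<And>x. x \<in> V \<Longrightarrow> \<psi> (\<iota> x) = \<phi> x"
proof -
  obtain i where i: "Vector_Spaces.linear s t i" "\<And>x. x \<in> V \<Longrightarrow> i x = \<iota> x"
    using linear_map_on_extends_to_linear[OF vs(1,2) V \<iota>(1)] by blast
  obtain p where p: "Vector_Spaces.linear s u p" "\<And>x. x \<in> V \<Longrightarrow> p x = \<phi> x"
    using linear_map_on_extends_to_linear[OF vs(1,3) V \<phi>] by blast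
  interpret vector_space_pair s t
    using vs by (simp add: vector_space_pair_def)
  have "inj_on i V"
    using \<iota>(2) i(2) by (simp cong: inj_on_cong)
  then obtain r where r: "range r \<subseteq> V" "Vector_Spaces.linear t s r" "\<And>x. x \<in> V \<Longrightarrow> r (i x) = x"
    using linear_exists_left_inverse_on[OF i(1) V] by blast
  interpret p: Vector_Spaces.linear s u p by (rule p(1))
  interpret r: Vector_Spaces.linear t s r by (rule r(2))
  have "p (r y) \<in> U" for y
  proof -
    have "r y \<in> V" using r(1) by blast
    then show ?thesis using p(2) \<phi> by (simp add: linear_map_on_def)
  qed
  then have "linear_map_on t u W U (\<lambda>y. p (r y))"
    by (simp add: linear_map_on_def p.add p.scale r.add r.scale)
  moreover have "p (r (\<iota> x)) = \<phi> x" if "x \<in> V" for x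
    using that i(2) p(2) r(3) by metis
  ultimately show thesis by (rule that)
qed

section \<open>Injectivity of direct sums of elementary sheaves\<close>

lemma vector_space_pointwise_scale:
  "vector_space s \<Longrightarrow> vector_space (pointwise_scale s)"
  unfolding vector_space_def pointwise_scale_def by (auto simp: fun_eq_iff)

lemma sum_fun_apply: "(\<Sum>i\<in>J. f i) x = (\<Sum>i\<in>J. f i x)"
  for f :: "'i \<Rightarrow> 'a \<Rightarrow> 'b::comm_monoid_add"
  by (induction J rule: infinite_finite_induct) auto

text \<open>
  The images of finite generating sets of the summands together generate the direct sum, because an
  element is the sum of the inclusions of its components.  Finiteness of \<open>J\<close> keeps both this sum and
  the generating set finite.
\<close>

lemma finite_dim_subspace_direct_sum:
  fixes s :: "'k::field \<Rightarrow> 'v::ab_group_add \<Rightarrow> 'v" and V :: "'i \<Rightarrow> 'v set"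
  assumes "vector_space s" and J: "finite J"
    and V: "\<And>i. i \<in> J \<Longrightarrow> finite_dim_subspace s (V i)"
  shows "finite_dim_subspace (pointwise_scale s)
           {x. (\<forall>i\<in>J. x i \<in> V i) \<and> (\<forall>i. i \<notin> J \<longrightarrow> x i = 0)}" (is "finite_dim_subspace _ ?D")
proof -
  interpret vector_space s by fact
  interpret D: vector_space "pointwise_scale s"
    by (rule vector_space_pointwise_scale) fact
  have subV: "subspace (V i)" if "i \<in> J" for i
    using V that by (simp add: finite_dim_subspace_def)
  have subD: "D.subspace ?D"
    by (rule D.subspaceI)
      (auto simp: pointwise_scale_def subspace_0 subspace_add subspace_scale subV)
  obtain B where B: "\<And>i. i \<in> J \<Longrightarrow> finite (B i) \<and> B i \<subseteq> V i \<and> span (B i) = V i"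
    using V unfolding finite_dim_subspace_def by metis
  define C where "C = (\<Union>i\<in>J. summand_incl i ` B i)"
  have "C \<subseteq> ?D"
    using B subspace_0[OF subV] by (fastforce simp: C_def summand_incl_def)
  have incl: "summand_incl i v \<in> D.span C" if "i \<in> J" "v \<in> V i" for i v
  proof -
    have "v \<in> span (B i)" using B that by simp
    then show ?thesis
    proof (induction rule: span_induct_alt)
      case base
      have "summand_incl i (0::'v) = 0" by (auto simp: summand_incl_def)
      then show ?case by (metis D.span_zero)
    next
      case (step c x y)
      have "summand_incl i x \<in> C" using step(1) that by (auto simp: C_def)
      then have "pointwise_scale s c (summand_incl i x) + summand_incl i y \<in> D.span C"
        using step(2) by (simp add: D.span_add D.span_scale D.span_base)
      moreover have "pointwise_scale s c (summand_incl i x) + summand_incl i y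
          = summand_incl i (s c x + y)"
        by (auto simp: pointwise_scale_def summand_incl_def fun_eq_iff)
      ultimately show ?case by simp
    qed
  qed
  have "x \<in> D.span C" if "x \<in> ?D" for x
  proof -
    have "x = (\<Sum>i\<in>J. summand_incl i (x i))"
      using that J by (auto simp: fun_eq_iff sum_fun_apply summand_incl_def)
    also have "\<dots> \<in> D.span C"
      using that incl by (intro D.span_sum) auto
    finally show ?thesis .
  qed
  then have "D.span C = ?D"
    using D.span_minimal[OF \<open>C \<subseteq> ?D\<close> subD] by blast
  moreover have "finite C"
    using B J by (auto simp: C_def)
  ultimately show ?thesis
    using subD \<open>C \<subseteq> ?D\<close> unfolding finite_dim_subspace_def by blast
qed

lemma sheaf_direct_sum:
  fixes s :: "'k::field \<Rightarrow> 'v::ab_group_add \<Rightarrow> 'v" and P :: "'p::order set"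
  assumes "vector_space s" and J: "finite J" and G: "\<And>i. i \<in> J \<Longrightarrow> sheaf s P (G i)"
  shows "sheaf (pointwise_scale s) P (direct_sum J G)"
proof -
  have st: "stalk (direct_sum J G) \<pi>
      = {x. (\<forall>i\<in>J. x i \<in> stalk (G i) \<pi>) \<and> (\<forall>i. i \<notin> J \<longrightarrow> x i = 0)}" for \<pi>
    by (simp add: direct_sum_def)
  have fd: "finite_dim_subspace (pointwise_scale s) (stalk (direct_sum J G) \<pi>)" if "\<pi> \<in> P" for \<pi>
    unfolding st using G that
    by (intro finite_dim_subspace_direct_sum assms(1) J) (simp add: sheaf_def)
  interpret vector_space s by fact
  have lin: "linear_map_on (pointwise_scale s) (pointwise_scale s)
      (stalk (direct_sum J G) \<sigma>) (stalk (direct_sum J G) \<tau>) (res (direct_sum J G) \<sigma> \<tau>)"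
    if "\<sigma> \<in> P" "\<tau> \<in> P" "\<sigma> \<le> \<tau>" for \<sigma> \<tau>
  proof -
    have "linear_map_on s s (stalk (G i) \<sigma>) (stalk (G i) \<tau>) (res (G i) \<sigma> \<tau>)" if "i \<in> J" for i
      using G[OF that] \<open>\<sigma> \<in> P\<close> \<open>\<tau> \<in> P\<close> \<open>\<sigma> \<le> \<tau>\<close> unfolding sheaf_def by blast
    then show ?thesis
      by (auto simp: linear_map_on_def direct_sum_def pointwise_scale_def fun_eq_iff)
  qed
  have ident: "res (direct_sum J G) \<pi> \<pi> x = x"
    if "\<pi> \<in> P" "x \<in> stalk (direct_sum J G) \<pi>" for \<pi> x
    using that G by (auto simp: direct_sum_def sheaf_def fun_eq_iff)
  have comp: "res (direct_sum J G) \<tau> \<gamma> (res (direct_sum J G) \<sigma> \<tau> x) = res (direct_sum J G) \<sigma> \<gamma> x"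
    if "\<sigma> \<in> P" "\<tau> \<in> P" "\<gamma> \<in> P" "\<sigma> \<le> \<tau>" "\<tau> \<le> \<gamma>" "x \<in> stalk (direct_sum J G) \<sigma>" for \<sigma> \<tau> \<gamma> x
  proof
    fix i
    show "res (direct_sum J G) \<tau> \<gamma> (res (direct_sum J G) \<sigma> \<tau> x) i = res (direct_sum J G) \<sigma> \<gamma> x i"
    proof (cases "i \<in> J")
      case True
      with that have "x i \<in> stalk (G i) \<sigma>" by (simp add: direct_sum_def)
      then have "res (G i) \<tau> \<gamma> (res (G i) \<sigma> \<tau> (x i)) = res (G i) \<sigma> \<gamma> (x i)"
        using G[OF True] that(1-5) unfolding sheaf_def by blast
      with True show ?thesis by (simp add: direct_sum_def)
    qed (simp add: direct_sum_def)
  qed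
  show ?thesis
    unfolding sheaf_def
    using vector_space_pointwise_scale[OF assms(1)] fd lin ident comp by blast
qed

lemma sheaf_elementary:
  fixes s :: "'k::field \<Rightarrow> 'v::ab_group_add \<Rightarrow> 'v" and P :: "'p::order set"
  assumes "vector_space s" and V: "finite_dim_subspace s V"
  shows "sheaf s P (elementary_sheaf \<pi> V)"
proof -
  interpret vector_space s by fact
  have sub: "subspace V" using V by (simp add: finite_dim_subspace_def)
  have "finite_dim_subspace s {0}"
    unfolding finite_dim_subspace_def by (auto intro!: exI[of _ "{}"])
  then show ?thesis
    using V assms(1) subspace_0[OF sub]
    by (auto simp: sheaf_def elementary_sheaf_def linear_map_on_def dest: order_trans)
qed

text \<open>
  Restriction to \<open>\<pi>\<close> is a bijection between natural transformations \<open>B \<rightarrow> [\<pi>]\<^sup>V\<close> and linear maps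
  \<open>B(\<pi>) \<rightarrow> V\<close>: naturality forces the value at \<open>\<gamma> \<le> \<pi>\<close> to be the composite with \<open>B(\<gamma> \<le> \<pi>)\<close>.
  Extending a natural transformation is therefore the same as extending one linear map at \<open>\<pi>\<close>.
\<close>

lemma injective_elementary_sheaf:
  fixes s :: "'k::field \<Rightarrow> 'v::ab_group_add \<Rightarrow> 'v" and P :: "'p::order set"
  assumes vs: "vector_space s" and V: "finite_dim_subspace s V" and \<pi>: "\<pi> \<in> P"
  shows "injective_sheaf TYPE('a::ab_group_add) TYPE('b::ab_group_add) s P (elementary_sheaf \<pi> V)"
proof -
  let ?E = "elementary_sheaf \<pi> V"
  interpret vector_space s by fact
  have "\<exists>\<psi>. nat_trans sB s P B ?E \<psi> \<and> (\<forall>\<sigma>\<in>P. \<forall>x\<in>stalk A \<sigma>. \<psi> \<sigma> (\<iota> \<sigma> x) = \<phi> \<sigma> x)"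
    if A: "sheaf sA P A" and B: "sheaf sB P B"
      and \<iota>: "nat_trans sA sB P A B \<iota>" "injective_nat_trans P A \<iota>"
      and \<phi>: "nat_trans sA s P A ?E \<phi>"
    for sA :: "'k \<Rightarrow> 'a \<Rightarrow> 'a" and sB :: "'k \<Rightarrow> 'b \<Rightarrow> 'b" and A B \<iota> \<phi>
  proof -
    have "linear_map_on sA s (stalk A \<pi>) V (\<phi> \<pi>)"
      using \<phi> \<pi> by (force simp: nat_trans_def elementary_sheaf_def)
    moreover have "vector_space sA" "vector_space sB" "module.subspace sA (stalk A \<pi>)"
      using A B \<pi> by (auto simp: sheaf_def finite_dim_subspace_def)
    moreover have "linear_map_on sA sB (stalk A \<pi>) (stalk B \<pi>) (\<iota> \<pi>)" "inj_on (\<iota> \<pi>) (stalk A \<pi>)"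
      using \<iota> \<pi> by (auto simp: nat_trans_def injective_nat_trans_def)
    ultimately obtain f where f: "linear_map_on sB s (stalk B \<pi>) V f"
      and f\<iota>: "\<And>x. x \<in> stalk A \<pi> \<Longrightarrow> f (\<iota> \<pi> x) = \<phi> \<pi> x"
      using vector_space_injective[of sA sB s] vs by metis
    define \<psi> where "\<psi> \<gamma> x = (if \<gamma> \<le> \<pi> then f (res B \<gamma> \<pi> x) else 0)" for \<gamma> x
    have lin: "linear_map_on sB s (stalk B \<gamma>) (stalk ?E \<gamma>) (\<psi> \<gamma>)" if "\<gamma> \<in> P" for \<gamma>
    proof (cases "\<gamma> \<le> \<pi>")
      case True
      then have "linear_map_on sB sB (stalk B \<gamma>) (stalk B \<pi>) (res B \<gamma> \<pi>)"
        using B that \<pi> unfolding sheaf_def by blast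
      with f True show ?thesis
        by (simp add: linear_map_on_def \<psi>_def elementary_sheaf_def)
    qed (simp add: linear_map_on_def \<psi>_def elementary_sheaf_def)
    have nat: "\<psi> \<tau> (res B \<sigma> \<tau> x) = res ?E \<sigma> \<tau> (\<psi> \<sigma> x)"
      if "\<sigma> \<in> P" "\<tau> \<in> P" "\<sigma> \<le> \<tau>" "x \<in> stalk B \<sigma>" for \<sigma> \<tau> x
    proof (cases "\<tau> \<le> \<pi>")
      case True
      then have "res B \<tau> \<pi> (res B \<sigma> \<tau> x) = res B \<sigma> \<pi> x"
        using B that \<pi> unfolding sheaf_def by blast
      with True that show ?thesis by (auto simp: \<psi>_def elementary_sheaf_def)
    qed (simp add: \<psi>_def elementary_sheaf_def)
    have ext: "\<psi> \<sigma> (\<iota> \<sigma> x) = \<phi> \<sigma> x" if "\<sigma> \<in> P" "x \<in> stalk A \<sigma>" for \<sigma> x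
    proof (cases "\<sigma> \<le> \<pi>")
      case True
      then have "\<iota> \<pi> (res A \<sigma> \<pi> x) = res B \<sigma> \<pi> (\<iota> \<sigma> x)" "\<phi> \<pi> (res A \<sigma> \<pi> x) = res ?E \<sigma> \<pi> (\<phi> \<sigma> x)"
        using \<iota>(1) \<phi> that \<pi> unfolding nat_trans_def by blast+
      moreover have "res A \<sigma> \<pi> x \<in> stalk A \<pi>"
        using A that \<pi> True unfolding sheaf_def linear_map_on_def by blast
      ultimately have "f (res B \<sigma> \<pi> (\<iota> \<sigma> x)) = res ?E \<sigma> \<pi> (\<phi> \<sigma> x)"
        using f\<iota> by metis
      with True show ?thesis by (simp add: \<psi>_def elementary_sheaf_def)
    next
      case False
      have "\<phi> \<sigma> x \<in> stalk ?E \<sigma>"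
        using \<phi> that unfolding nat_trans_def linear_map_on_def by blast
      with False show ?thesis by (simp add: \<psi>_def elementary_sheaf_def)
    qed
    show ?thesis
      using lin nat ext unfolding nat_trans_def by blast
  qed
  then show ?thesis
    unfolding injective_sheaf_def using sheaf_elementary[OF vs V] by blast
qed

text \<open>
  A finite direct sum is a product, so an extension can be chosen in each component separately.
\<close>

lemma injective_direct_sum:
  fixes s :: "'k::field \<Rightarrow> 'v::ab_group_add \<Rightarrow> 'v" and P :: "'p::order set"
  assumes vs: "vector_space s" and J: "finite J"
    and G: "\<And>i. i \<in> J \<Longrightarrow> injective_sheaf TYPE('a::ab_group_add) TYPE('b::ab_group_add) s P (G i)"
  shows "injective_sheaf TYPE('a) TYPE('b) (pointwise_scale s) P (direct_sum J G)"
proof -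
  let ?D = "direct_sum J G"
  have "\<exists>\<psi>. nat_trans sB (pointwise_scale s) P B ?D \<psi> \<and> (\<forall>\<sigma>\<in>P. \<forall>x\<in>stalk A \<sigma>. \<psi> \<sigma> (\<iota> \<sigma> x) = \<phi> \<sigma> x)"
    if A: "sheaf sA P A" and B: "sheaf sB P B"
      and \<iota>: "nat_trans sA sB P A B \<iota>" "injective_nat_trans P A \<iota>"
      and \<phi>: "nat_trans sA (pointwise_scale s) P A ?D \<phi>"
    for sA :: "'k \<Rightarrow> 'a \<Rightarrow> 'a" and sB :: "'k \<Rightarrow> 'b \<Rightarrow> 'b" and A B \<iota> \<phi>
  proof -
    have \<phi>_in: "\<phi> \<sigma> x \<in> stalk ?D \<sigma>" if "\<sigma> \<in> P" "x \<in> stalk A \<sigma>" for \<sigma> x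
      using \<phi> that unfolding nat_trans_def linear_map_on_def by blast
    have "nat_trans sA s P A (G i) (\<lambda>\<sigma> x. \<phi> \<sigma> x i)" if "i \<in> J" for i
      using \<phi> that
      by (auto simp: nat_trans_def linear_map_on_def direct_sum_def pointwise_scale_def)
    then have "\<exists>\<psi>. nat_trans sB s P B (G i) \<psi> \<and> (\<forall>\<sigma>\<in>P. \<forall>x\<in>stalk A \<sigma>. \<psi> \<sigma> (\<iota> \<sigma> x) = \<phi> \<sigma> x i)"
      if "i \<in> J" for i
      using G[OF that] A B \<iota> that unfolding injective_sheaf_def by blast
    then obtain \<Psi> where \<Psi>: "\<And>i. i \<in> J \<Longrightarrow> nat_trans sB s P B (G i) (\<Psi> i)"
      "\<And>i \<sigma> x. i \<in> J \<Longrightarrow> \<sigma> \<in> P \<Longrightarrow> x \<in> stalk A \<sigma> \<Longrightarrow> \<Psi> i \<sigma> (\<iota> \<sigma> x) = \<phi> \<sigma> x i"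
      by metis
    define \<psi> where "\<psi> \<sigma> x = (\<lambda>i. if i \<in> J then \<Psi> i \<sigma> x else 0)" for \<sigma> x
    interpret vector_space s by fact
    have "nat_trans sB (pointwise_scale s) P B ?D \<psi>"
      using \<Psi>(1)
      by (auto simp: nat_trans_def linear_map_on_def direct_sum_def pointwise_scale_def
          \<psi>_def fun_eq_iff)
    moreover have "\<psi> \<sigma> (\<iota> \<sigma> x) = \<phi> \<sigma> x" if "\<sigma> \<in> P" "x \<in> stalk A \<sigma>" for \<sigma> x
      using \<Psi>(2)[OF _ that] \<phi>_in[OF that] by (auto simp: \<psi>_def direct_sum_def)
    ultimately show ?thesis by blast
  qed
  moreover have "sheaf (pointwise_scale s) P ?D"
    using G by (intro sheaf_direct_sum vs J) (simp add: injective_sheaf_def)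
  ultimately show ?thesis
    unfolding injective_sheaf_def by blast
qed

section \<open>Facets of chains\<close>

lemma facet_Cons: "c <\<^sub>1 a # d \<longleftrightarrow> c = d \<or> (\<exists>c'. c = a # c' \<and> c' <\<^sub>1 d)"
proof
  assume "c <\<^sub>1 a # d"
  then obtain xs x ys where *: "a # d = xs @ x # ys" "c = xs @ ys"
    unfolding facet_def by blast
  then show "c = d \<or> (\<exists>c'. c = a # c' \<and> c' <\<^sub>1 d)"
    by (cases xs) (auto simp: facet_def)
next
  assume "c = d \<or> (\<exists>c'. c = a # c' \<and> c' <\<^sub>1 d)"
  then show "c <\<^sub>1 a # d"
  proof
    assume "c = d"
    then show ?thesis
      unfolding facet_def by (intro exI[of _ "[]"] exI[of _ a] exI[of _ d]) simp
  next
    assume "\<exists>c'. c = a # c' \<and> c' <\<^sub>1 d"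
    then obtain xs x ys where "c = a # xs @ ys" "d = xs @ x # ys"
      unfolding facet_def by blast
    then show ?thesis
      unfolding facet_def by (intro exI[of _ "a # xs"] exI[of _ x] exI[of _ ys]) simp
  qed
qed

lemma not_facet_Nil [simp]: "\<not> c <\<^sub>1 []"
  by (simp add: facet_def)

lemma facet_length: "c <\<^sub>1 d \<Longrightarrow> length d = Suc (length c)"
  by (auto simp: facet_def)

lemma facet_of_chain:
  assumes "c <\<^sub>1 d" "sorted_wrt (<) d"
  shows "set c \<subseteq> set d" "sorted_wrt (<) c"
  using assms by (auto simp: facet_def sorted_wrt_append)

text \<open>
  These two inequalities make the maps of the complex well defined: \<open>last c \<le> last d\<close> gives a map of
  \<open>F\<close> between the coefficients, and \<open>hd d \<le> hd c\<close> a map between the elementary sheaves.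
\<close>

lemma facet_hd_last:
  fixes c d :: "'p::order list"
  assumes "c <\<^sub>1 d" "sorted_wrt (<) d" "c \<noteq> []"
  shows "hd d \<le> hd c" "last c \<le> last d"
proof -
  obtain xs x ys where *: "d = xs @ x # ys" "c = xs @ ys"
    using assms(1) unfolding facet_def by blast
  show "hd d \<le> hd c"
    using * assms(2,3) by (cases xs; cases ys) auto
  show "last c \<le> last d"
    using * assms(2,3) by (cases ys rule: rev_cases; cases xs rule: rev_cases)
      (auto simp: sorted_wrt_append)
qed

lemma finite_order_complex:
  fixes P :: "'p::order set"
  assumes "finite P"
  shows "finite (order_complex P)"
proof -
  have "distinct c" if "sorted_wrt (<) c" for c :: "'p list"
    using that by (induction c) auto
  then have "order_complex P \<subseteq> {c. set c \<subseteq> P \<and> distinct c}"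
    by (auto simp: order_complex_def)
  then show ?thesis
    using finite_subset finite_subset_distinct[OF assms] by blast
qed

lemma simplices_iff:
  "c \<in> simplices P j \<longleftrightarrow> length c = Suc j \<and> set c \<subseteq> P \<and> sorted_wrt (<) c"
  by (auto simp: simplices_def order_complex_def)

lemma simplices_order_complex: "c \<in> simplices P j \<Longrightarrow> c \<in> order_complex P"
  by (simp add: simplices_def)

lemma simplices_Cons:
  "c \<in> simplices P j \<Longrightarrow> a # c \<in> simplices P (Suc j) \<longleftrightarrow> a \<in> P \<and> a < hd c"
  by (cases c) (auto simp: simplices_iff)

lemma facet_simplices: "c <\<^sub>1 d \<Longrightarrow> d \<in> simplices P (Suc j) \<Longrightarrow> c \<in> simplices P j"
  using facet_of_chain facet_length by (force simp: simplices_iff)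

text \<open>
  The facets of a cone \<open>\<sigma> # d\<close> are its base and the cones over the facets of the base.  For a vertex
  \<open>d = [\<gamma>]\<close> the only facet of the base is the empty list, and the cone over it is the vertex \<open>[\<sigma>]\<close>.
\<close>

lemma facets_Cons:
  fixes P :: "'p::order set"
  assumes "\<sigma> \<in> P" "d \<in> simplices P j" "\<sigma> < hd d"
  shows "{c. c \<in> simplices P j \<and> c <\<^sub>1 \<sigma> # d} = insert d ((#) \<sigma> ` {c. c <\<^sub>1 d})"
    and "d \<notin> (#) \<sigma> ` {c. c <\<^sub>1 d}"
proof -
  have "\<sigma> # d \<in> simplices P (Suc j)"
    using assms by (simp add: simplices_Cons)
  then have "{c. c \<in> simplices P j \<and> c <\<^sub>1 \<sigma> # d} = {c. c <\<^sub>1 \<sigma> # d}"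
    using facet_simplices by blast
  also have "\<dots> = insert d ((#) \<sigma> ` {c. c <\<^sub>1 d})"
    by (auto simp: facet_Cons)
  finally show "{c. c \<in> simplices P j \<and> c <\<^sub>1 \<sigma> # d} = insert d ((#) \<sigma> ` {c. c <\<^sub>1 d})" .
  show "d \<notin> (#) \<sigma> ` {c. c <\<^sub>1 d}"
    using assms(3) by auto
qed

lemma finite_facets: "finite {c. c <\<^sub>1 d}"
proof (induction d)
  case (Cons a d)
  have "{c. c <\<^sub>1 a # d} = insert d ((#) a ` {c. c <\<^sub>1 d})"
    by (auto simp: facet_Cons)
  with Cons show ?case by simp
qed simp

section \<open>The complex and its maps\<close>

text \<open>
  The hypotheses on the sheaf and on the incidence numbers, shared by everything about the complex.
  In it, \<open>R j\<close> is the sheaf \<open>I\<^sup>j\<close>, and \<open>\<epsilon>\<close> gives the incidence numbers as elements of the field.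
\<close>

locale sheaf_with_incidence_numbers =
  fixes scale :: "'k::field \<Rightarrow> 'v::ab_group_add \<Rightarrow> 'v"
    and P :: "'p::order set"
    and F :: "('p, 'v) sheaf_data"
    and inc :: "'p list \<Rightarrow> 'p list \<Rightarrow> int"
  assumes finite_P: "finite P"
    and sheaf_F: "sheaf scale P F"
    and signed: "signed_incidence_relation P inc"
    and nonzero: "nonzero_on_facets P inc"
    and opposite: "opposite_on_edges TYPE('k) P inc"
begin

sublocale vector_space scale
  using sheaf_F unfolding sheaf_def by blast

abbreviation \<epsilon> :: "'p list \<Rightarrow> 'p list \<Rightarrow> 'k" where
  "\<epsilon> c d \<equiv> of_int (inc c d)"

abbreviation F_map :: "'p list \<Rightarrow> 'p list \<Rightarrow> 'v \<Rightarrow> 'v" where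
  "F_map c d \<equiv> res F (last c) (last d)"

abbreviation R :: "nat \<Rightarrow> ('p, 'p list \<Rightarrow> 'v) sheaf_data" where
  "R \<equiv> resolution_sheaf P F"

abbreviation \<delta> :: "nat \<Rightarrow> 'p \<Rightarrow> ('p list \<Rightarrow> 'v) \<Rightarrow> 'p list \<Rightarrow> 'v" where
  "\<delta> \<equiv> resolution_map scale P F inc"

abbreviation \<alpha> :: "'p \<Rightarrow> 'v \<Rightarrow> 'p list \<Rightarrow> 'v" where
  "\<alpha> \<equiv> resolution_augmentation P F"

lemma finite_simplices [simp]: "finite (simplices P j)"
  using finite_order_complex[OF finite_P] by (simp add: simplices_def)

lemma simplex_ends: "c \<in> simplices P j \<Longrightarrow> c \<noteq> [] \<and> hd c \<in> P \<and> last c \<in> P"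
  by (cases c) (auto simp: simplices_iff)

lemma subspace_stalk: "\<pi> \<in> P \<Longrightarrow> subspace (stalk F \<pi>)"
  using sheaf_F by (simp add: sheaf_def finite_dim_subspace_def)

lemma res_linear:
  "\<sigma> \<in> P \<Longrightarrow> \<tau> \<in> P \<Longrightarrow> \<sigma> \<le> \<tau> \<Longrightarrow> linear_map_on scale scale (stalk F \<sigma>) (stalk F \<tau>) (res F \<sigma> \<tau>)"
  using sheaf_F unfolding sheaf_def by blast

lemma res_ident: "\<pi> \<in> P \<Longrightarrow> x \<in> stalk F \<pi> \<Longrightarrow> res F \<pi> \<pi> x = x"
  using sheaf_F unfolding sheaf_def by blast

lemma res_comp:
  "\<sigma> \<in> P \<Longrightarrow> \<tau> \<in> P \<Longrightarrow> \<gamma> \<in> P \<Longrightarrow> \<sigma> \<le> \<tau> \<Longrightarrow> \<tau> \<le> \<gamma> \<Longrightarrow> x \<in> stalk F \<sigma> \<Longrightarrow>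
    res F \<tau> \<gamma> (res F \<sigma> \<tau> x) = res F \<sigma> \<gamma> x"
  using sheaf_F unfolding sheaf_def by blast

lemma res_simps:
  assumes "\<sigma> \<in> P" "\<tau> \<in> P" "\<sigma> \<le> \<tau>"
  shows res_stalk: "x \<in> stalk F \<sigma> \<Longrightarrow> res F \<sigma> \<tau> x \<in> stalk F \<tau>"
    and res_add: "x \<in> stalk F \<sigma> \<Longrightarrow> y \<in> stalk F \<sigma> \<Longrightarrow> res F \<sigma> \<tau> (x + y) = res F \<sigma> \<tau> x + res F \<sigma> \<tau> y"
    and res_scale: "x \<in> stalk F \<sigma> \<Longrightarrow> res F \<sigma> \<tau> (scale k x) = scale k (res F \<sigma> \<tau> x)"
    and res_zero: "res F \<sigma> \<tau> 0 = 0"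
    and res_sum: "(\<And>i. i \<in> J \<Longrightarrow> f i \<in> stalk F \<sigma>) \<Longrightarrow> res F \<sigma> \<tau> (\<Sum>i\<in>J. f i) = (\<Sum>i\<in>J. res F \<sigma> \<tau> (f i))"
proof -
  note lin = res_linear[OF assms]
  show "x \<in> stalk F \<sigma> \<Longrightarrow> res F \<sigma> \<tau> x \<in> stalk F \<tau>"
    "x \<in> stalk F \<sigma> \<Longrightarrow> y \<in> stalk F \<sigma> \<Longrightarrow> res F \<sigma> \<tau> (x + y) = res F \<sigma> \<tau> x + res F \<sigma> \<tau> y"
    "x \<in> stalk F \<sigma> \<Longrightarrow> res F \<sigma> \<tau> (scale k x) = scale k (res F \<sigma> \<tau> x)"
    using lin by (auto simp: linear_map_on_def)
  show "res F \<sigma> \<tau> 0 = 0"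
    using linear_map_on_zero[OF lin] subspace_0[OF subspace_stalk] assms(1) by blast
  show "(\<And>i. i \<in> J \<Longrightarrow> f i \<in> stalk F \<sigma>) \<Longrightarrow> res F \<sigma> \<tau> (\<Sum>i\<in>J. f i) = (\<Sum>i\<in>J. res F \<sigma> \<tau> (f i))"
    by (rule linear_map_on_sum[OF vector_space_axioms subspace_stalk lin]) (use assms in auto)
qed

lemma incidence_zero: "c \<in> order_complex P \<Longrightarrow> d \<in> order_complex P \<Longrightarrow> \<not> c <\<^sub>1 d \<Longrightarrow> inc c d = 0"
  using signed unfolding signed_incidence_relation_def by blast

lemma facet_if_incident:
  "c \<in> simplices P i \<Longrightarrow> d \<in> simplices P j \<Longrightarrow> \<epsilon> c d \<noteq> 0 \<Longrightarrow> c <\<^sub>1 d"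
  using incidence_zero simplices_order_complex of_int_0 by metis

lemma incidence_square:
  assumes "c \<in> order_complex P" "d \<in> order_complex P" "c <\<^sub>1 d"
  shows "\<epsilon> c d * \<epsilon> c d = 1"
proof -
  have "inc c d \<in> {-1, 0, 1}" "inc c d \<noteq> 0"
    using signed nonzero assms unfolding signed_incidence_relation_def nonzero_on_facets_def
    by blast+
  then show ?thesis by auto
qed

lemma incidence_sum:
  assumes "c \<in> simplices P j" "e \<in> order_complex P"
  shows "(\<Sum>d\<in>simplices P (Suc j). \<epsilon> c d * \<epsilon> d e) = 0"
proof -
  have "(\<Sum>d\<in>simplices P (Suc j). inc c d * inc d e) = (\<Sum>d\<in>order_complex P. inc c d * inc d e)"
  proof (rule sum.mono_neutral_left)
    show "\<forall>d\<in>order_complex P - simplices P (Suc j). inc c d * inc d e = 0"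
    proof
      fix d assume "d \<in> order_complex P - simplices P (Suc j)"
      then have "\<not> c <\<^sub>1 d" "d \<in> order_complex P"
        using assms(1) by (auto simp: simplices_def dest: facet_length)
      then show "inc c d * inc d e = 0"
        using incidence_zero simplices_order_complex[OF assms(1)] by simp
    qed
  qed (auto simp: simplices_order_complex finite_order_complex finite_P)
  also have "\<dots> = 0"
    using signed assms simplices_order_complex unfolding signed_incidence_relation_def by blast
  finally have "of_int (\<Sum>d\<in>simplices P (Suc j). inc c d * inc d e) = (0::'k)" by simp
  then show ?thesis by simp
qed

text \<open>
  An element of the stalk at \<open>\<sigma>\<close> is a cochain on the chains in \<open>{\<tau>. \<sigma> \<le> \<tau>}\<close>, whose value on a
  chain lies in the stalk of \<open>F\<close> at the end of that chain.
\<close>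

lemma stalk_resolution_sheaf:
  "x \<in> stalk (R j) \<sigma> \<longleftrightarrow>
     (\<forall>c\<in>simplices P j. x c \<in> stalk F (last c)) \<and>
     (\<forall>c. x c \<noteq> 0 \<longrightarrow> c \<in> simplices P j \<and> \<sigma> \<le> hd c)"
proof -
  have "0 \<in> stalk F (last c)" if "c \<in> simplices P j" for c
    using subspace_0[OF subspace_stalk] simplex_ends[OF that] by blast
  then show ?thesis
    by (fastforce simp: resolution_sheaf_def direct_sum_def elementary_sheaf_def split: if_splits)
qed

lemma res_resolution_sheaf:
  "res (R j) \<sigma> \<tau> x c = (if c \<in> simplices P j \<and> \<sigma> \<le> \<tau> \<and> \<tau> \<le> hd c then x c else 0)"
  by (simp add: resolution_sheaf_def direct_sum_def elementary_sheaf_def)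

lemma facet_ends:
  assumes "c \<in> simplices P j" "d \<in> simplices P i" "c <\<^sub>1 d"
  shows "last c \<in> P" "last d \<in> P" "last c \<le> last d" "hd d \<le> hd c"
  using assms facet_hd_last[OF assms(3)] simplex_ends by (auto simp: simplices_iff)

text \<open>
  Into the component \<open>d\<close> every summand contributes under the same condition \<open>\<gamma> \<le> hd d\<close>.  Collecting
  these contributions turns the map, defined summand by summand of its source, into the usual
  simplicial coboundary, a sum over the facets of \<open>d\<close>.
\<close>

lemma resolution_map_apply:
  "\<delta> j \<gamma> x d =
     (if d \<in> simplices P (Suc j) \<and> \<gamma> \<le> hd d
      then \<Sum>c | c \<in> simplices P j \<and> c <\<^sub>1 d. scale (\<epsilon> c d) (F_map c d (x c)) else 0)"
proof -
  let ?t = "\<lambda>c e. scale (\<epsilon> c e) (elementary_hom (hd e) (F_map c e) \<gamma> (x c))"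
  have "(\<Sum>e | e \<in> simplices P (Suc j) \<and> c <\<^sub>1 e. summand_incl e (?t c e) d)
      = (if d \<in> simplices P (Suc j) \<and> c <\<^sub>1 d then ?t c d else 0)" for c
    by (simp add: summand_incl_def)
  then have "\<delta> j \<gamma> x d
      = (\<Sum>c\<in>simplices P j. if d \<in> simplices P (Suc j) \<and> c <\<^sub>1 d then ?t c d else 0)"
    by (simp add: resolution_map_def sum_fun_apply)
  also have "\<dots> = (if d \<in> simplices P (Suc j)
      then \<Sum>c | c \<in> simplices P j \<and> c <\<^sub>1 d. ?t c d else 0)"
    by (simp add: sum.inter_filter)
  finally show ?thesis
    by (simp add: elementary_hom_def)
qed

lemma augmentation_apply:
  "\<alpha> \<sigma> v c = (if c \<in> simplices P 0 \<and> \<sigma> \<le> hd c then res F \<sigma> (hd c) v else 0)"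
proof -
  have "\<alpha> \<sigma> v c = (\<Sum>\<gamma> | \<gamma> \<in> P \<and> \<sigma> \<le> \<gamma>. if c = [\<gamma>] then res F \<sigma> \<gamma> v else 0)"
    by (simp add: resolution_augmentation_def sum_fun_apply summand_incl_def)
  also have "\<dots> = (if c \<in> simplices P 0 \<and> \<sigma> \<le> hd c then res F \<sigma> (hd c) v else 0)"
  proof (cases "\<exists>\<gamma>. c = [\<gamma>]")
    case True
    then show ?thesis using finite_P by (auto simp: simplices_iff split: if_splits)
  next
    case False
    then have "c \<notin> simplices P 0" by (auto simp: simplices_iff length_Suc_conv)
    with False show ?thesis by simp
  qed
  finally show ?thesis .
qed

lemma injective_resolution_sheaf: "injective_sheaf TYPE('a::ab_group_add) TYPE('b::ab_group_add) (pointwise_scale scale) P (R j)"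
  unfolding resolution_sheaf_def
  using sheaf_F simplex_ends
  by (intro injective_direct_sum injective_elementary_sheaf vector_space_axioms finite_simplices)
    (auto simp: sheaf_def)

lemma nat_trans_resolution_map:
  "nat_trans (pointwise_scale scale) (pointwise_scale scale) P (R j) (R (Suc j)) (\<delta> j)"
proof -
  have in_stalk: "\<delta> j \<gamma> x \<in> stalk (R (Suc j)) \<gamma>" if "x \<in> stalk (R j) \<gamma>" for \<gamma> x
  proof -
    have "(\<Sum>c | c \<in> simplices P j \<and> c <\<^sub>1 d. scale (\<epsilon> c d) (F_map c d (x c))) \<in> stalk F (last d)"
      if "d \<in> simplices P (Suc j)" for d
      using that \<open>x \<in> _\<close> facet_ends[OF _ that] simplex_ends
      by (intro subspace_sum subspace_scale subspace_stalk res_stalk) (auto simp: stalk_resolution_sheaf)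
    then show ?thesis
      using subspace_0[OF subspace_stalk] simplex_ends
      by (auto simp: stalk_resolution_sheaf resolution_map_apply)
  qed
  have add: "\<delta> j \<gamma> (x + y) = \<delta> j \<gamma> x + \<delta> j \<gamma> y"
    if "x \<in> stalk (R j) \<gamma>" "y \<in> stalk (R j) \<gamma>" for \<gamma> x y
    using that facet_ends
    by (auto simp: fun_eq_iff resolution_map_apply stalk_resolution_sheaf sum.distrib[symmetric]
        res_add scale_right_distrib intro!: sum.cong)
  have scale: "\<delta> j \<gamma> (pointwise_scale scale k x) = pointwise_scale scale k (\<delta> j \<gamma> x)"
    if "x \<in> stalk (R j) \<gamma>" for \<gamma> k x
    using that facet_ends
    by (auto simp: fun_eq_iff resolution_map_apply stalk_resolution_sheaf scale_sum_right pointwise_scale_def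
        res_scale mult.commute intro!: sum.cong)
  have nat: "\<delta> j \<tau> (res (R j) \<sigma> \<tau> x) d = res (R (Suc j)) \<sigma> \<tau> (\<delta> j \<sigma> x) d"
    if "\<sigma> \<le> \<tau>" for \<sigma> \<tau> x d
  proof (cases "d \<in> simplices P (Suc j) \<and> \<tau> \<le> hd d")
    case True
    then have "\<sigma> \<le> hd d" "\<And>c. c \<in> simplices P j \<Longrightarrow> c <\<^sub>1 d \<Longrightarrow> \<tau> \<le> hd c"
      using that facet_ends(4) order_trans by blast+
    with True that show ?thesis
      by (auto simp: resolution_map_apply res_resolution_sheaf intro!: sum.cong)
  qed (auto simp: resolution_map_apply res_resolution_sheaf)
  show ?thesis
    unfolding nat_trans_def linear_map_on_def using in_stalk add scale nat by blast
qed

lemma nat_trans_augmentation: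
  "nat_trans scale (pointwise_scale scale) P F (R 0) \<alpha>"
proof -
  have vertex: "last c = hd c" "hd c \<in> P" if "c \<in> simplices P 0" for c
    using that by (auto simp: simplices_iff length_Suc_conv)
  have "linear_map_on scale (pointwise_scale scale) (stalk F \<sigma>) (stalk (R 0) \<sigma>) (\<alpha> \<sigma>)"
    if "\<sigma> \<in> P" for \<sigma>
    using that vertex subspace_0[OF subspace_stalk]
    by (auto simp: linear_map_on_def stalk_resolution_sheaf augmentation_apply fun_eq_iff pointwise_scale_def
        res_simps)
  moreover have "\<alpha> \<tau> (res F \<sigma> \<tau> v) = res (R 0) \<sigma> \<tau> (\<alpha> \<sigma> v)"
    if "\<sigma> \<in> P" "\<tau> \<in> P" "\<sigma> \<le> \<tau>" "v \<in> stalk F \<sigma>" for \<sigma> \<tau> v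
    using that vertex
    by (auto simp: fun_eq_iff res_resolution_sheaf augmentation_apply res_comp dest: order_trans)
  ultimately show ?thesis
    by (simp add: nat_trans_def)
qed

section \<open>Consecutive maps compose to zero\<close>

text \<open>
  The maps of \<open>F\<close> along \<open>c\<close>, \<open>d\<close>, \<open>e\<close> compose to a map that does not depend on \<open>d\<close>.  Its coefficient
  in the double sum is \<open>\<Sum>d. \<epsilon> c d * \<epsilon> d e\<close>, which vanishes.
\<close>

lemma resolution_map_twice:
  assumes x: "x \<in> stalk (R j) \<gamma>"
  shows "\<delta> (Suc j) \<gamma> (\<delta> j \<gamma> x) = 0"
proof
  fix e
  show "\<delta> (Suc j) \<gamma> (\<delta> j \<gamma> x) e = 0 e"
  proof (cases "e \<in> simplices P (Suc (Suc j)) \<and> \<gamma> \<le> hd e")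
    case True
    \<comment> \<open>Non-facets have incidence number 0, so both sums may run over all simplices and be swapped.\<close>
    let ?t = "\<lambda>d c. scale (\<epsilon> c d * \<epsilon> d e) (F_map c e (x c))"
    have facet_term: "scale (\<epsilon> d e) (F_map d e (\<delta> j \<gamma> x d)) = (\<Sum>c\<in>simplices P j. ?t d c)"
      if d: "d \<in> simplices P (Suc j)" "d <\<^sub>1 e" for d
    proof -
      note de = facet_ends[OF d(1) conjunct1[OF True] d(2)]
      note cd = facet_ends[OF _ d(1)]
      have xc: "x c \<in> stalk F (last c)" if "c \<in> simplices P j" for c
        using that x by (simp add: stalk_resolution_sheaf)
      have "\<gamma> \<le> hd d" using True de(4) by auto
      then have "F_map d e (\<delta> j \<gamma> x d)
          = (\<Sum>c | c \<in> simplices P j \<and> c <\<^sub>1 d. F_map d e (scale (\<epsilon> c d) (F_map c d (x c))))"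
        using d de cd xc
        by (auto simp: resolution_map_apply intro!: res_sum subspace_scale subspace_stalk res_stalk)
      also have "\<dots> = (\<Sum>c | c \<in> simplices P j \<and> c <\<^sub>1 d. scale (\<epsilon> c d) (F_map c e (x c)))"
        using d de cd xc by (auto simp: res_scale res_stalk res_comp intro!: sum.cong)
      finally have "scale (\<epsilon> d e) (F_map d e (\<delta> j \<gamma> x d))
          = (\<Sum>c | c \<in> simplices P j \<and> c <\<^sub>1 d. ?t d c)"
        by (simp add: scale_sum_right mult.commute)
      also have "\<dots> = (\<Sum>c\<in>simplices P j. ?t d c)"
        using d by (intro sum.mono_neutral_left) (auto intro: facet_if_incident)
      finally show ?thesis .
    qed
    have "\<delta> (Suc j) \<gamma> (\<delta> j \<gamma> x) e
        = (\<Sum>d | d \<in> simplices P (Suc j) \<and> d <\<^sub>1 e. \<Sum>c\<in>simplices P j. ?t d c)"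
      using True facet_term by (simp add: resolution_map_apply[of "Suc j"])
    also have "\<dots> = (\<Sum>d\<in>simplices P (Suc j). \<Sum>c\<in>simplices P j. ?t d c)"
      using True by (intro sum.mono_neutral_left)
        (auto intro!: sum.neutral intro: facet_if_incident)
    also have "\<dots> = (\<Sum>c\<in>simplices P j. \<Sum>d\<in>simplices P (Suc j). ?t d c)"
      by (rule sum.swap)
    also have "\<dots> = (\<Sum>c\<in>simplices P j. scale (\<Sum>d\<in>simplices P (Suc j). \<epsilon> c d * \<epsilon> d e) (F_map c e (x c)))"
      by (simp only: scale_sum_left)
    also have "\<dots> = 0"
      using True incidence_sum[OF _ simplices_order_complex] by (intro sum.neutral) auto
    finally show ?thesis by simp
  qed (auto simp: resolution_map_apply)
qed

lemma edge_signs: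
  assumes "a \<in> P" "b \<in> P" "a < b"
  shows "\<epsilon> [a] [a, b] = - \<epsilon> [b] [a, b]" "\<epsilon> [b] [a, b] * \<epsilon> [b] [a, b] = 1"
proof -
  have "\<epsilon> [a] [a, b] + \<epsilon> [b] [a, b] = 0"
    using opposite assms by (simp add: opposite_on_edges_def)
  then show "\<epsilon> [a] [a, b] = - \<epsilon> [b] [a, b]"
    by (rule eq_neg_iff_add_eq_0[THEN iffD2])
  show "\<epsilon> [b] [a, b] * \<epsilon> [b] [a, b] = 1"
    using assms by (intro incidence_square) (auto simp: order_complex_def facet_Cons)
qed

text \<open>
  The same cancellation one degree lower, where the condition on the two ends of an edge replaces the
  sum over intermediate simplices.
\<close>

lemma resolution_map_augmentation:
  assumes \<sigma>: "\<sigma> \<in> P" and v: "v \<in> stalk F \<sigma>"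
  shows "\<delta> 0 \<sigma> (\<alpha> \<sigma> v) = 0"
proof
  fix d
  show "\<delta> 0 \<sigma> (\<alpha> \<sigma> v) d = 0 d"
  proof (cases "d \<in> simplices P (Suc 0) \<and> \<sigma> \<le> hd d")
    case True
    then obtain a b where d: "d = [a, b]" "a \<in> P" "b \<in> P" "a < b" "\<sigma> \<le> a"
      by (auto simp: simplices_iff length_Suc_conv)
    then have "\<sigma> \<le> b" by auto
    have facets: "{c. c \<in> simplices P 0 \<and> c <\<^sub>1 d} = {[a], [b]}"
      using d by (auto simp: facet_Cons simplices_iff)
    have "\<delta> 0 \<sigma> (\<alpha> \<sigma> v) d
        = scale (\<epsilon> [a] [a, b]) (res F a b (res F \<sigma> a v)) + scale (\<epsilon> [b] [a, b]) (res F b b (res F \<sigma> b v))"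
      unfolding resolution_map_apply facets
      using True d \<open>\<sigma> \<le> b\<close> by (simp add: augmentation_apply simplices_iff)
    also have "\<dots> = scale (\<epsilon> [a] [a, b] + \<epsilon> [b] [a, b]) (res F \<sigma> b v)"
      using d \<sigma> v \<open>\<sigma> \<le> b\<close> by (simp add: res_comp res_ident res_stalk scale_left_distrib)
    finally show ?thesis
      using edge_signs(1)[OF d(2-4)] by simp
  qed (auto simp: resolution_map_apply)
qed

section \<open>The cone over the least element\<close>

text \<open>
  The coboundary on a cone, split into the contribution of the base and that of the remaining facets,
  which contain the apex.  Prepending \<open>\<sigma>\<close> to \<open>d\<close> does not move its end, so \<open>F\<close> acts as the identity
  on the contribution of the base.
\<close>

lemma resolution_map_cone:
  assumes \<sigma>: "\<sigma> \<in> P" and d: "d \<in> simplices P j" "\<sigma> < hd d" and x: "x \<in> stalk (R j) \<sigma>"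
  shows "\<delta> j \<sigma> x (\<sigma> # d) = scale (\<epsilon> d (\<sigma> # d)) (x d)
      + (\<Sum>c | c <\<^sub>1 d. scale (\<epsilon> (\<sigma> # c) (\<sigma> # d)) (F_map (\<sigma> # c) d (x (\<sigma> # c))))"
proof -
  have d': "\<sigma> # d \<in> simplices P (Suc j)" "d \<noteq> []" "last d \<in> P"
    using \<sigma> d simplex_ends by (auto simp: simplices_Cons)
  have "x d \<in> stalk F (last d)" using x d by (simp add: stalk_resolution_sheaf)
  then have "F_map d (\<sigma> # d) (x d) = x d"
    using d' by (simp add: res_ident)
  then show ?thesis
    using d' facets_Cons[OF \<sigma> d]
    by (simp add: resolution_map_apply finite_facets sum.reindex)
qed

text \<open>
  The classical contraction of the cochains of a cone, evaluation on the cone over a chain.  The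
  factor \<open>\<epsilon> c (\<sigma> # c)\<close> corrects for an arbitrary choice of signs.
\<close>

definition contraction :: "'p \<Rightarrow> ('p list \<Rightarrow> 'v) \<Rightarrow> 'p list \<Rightarrow> 'v" where
  "contraction \<sigma> x c = (if \<sigma> < hd c then scale (\<epsilon> c (\<sigma> # c)) (x (\<sigma> # c)) else 0)"

lemma contraction_stalk:
  assumes "\<sigma> \<in> P" and x: "x \<in> stalk (R (Suc j)) \<sigma>"
  shows "contraction \<sigma> x \<in> stalk (R j) \<sigma>"
proof -
  have "contraction \<sigma> x c \<in> stalk F (last c)" if c: "c \<in> simplices P j" for c
  proof -
    have lc: "subspace (stalk F (last c))" "c \<noteq> []"
      using simplex_ends[OF c] subspace_stalk by auto
    have "x (\<sigma> # c) \<in> stalk F (last (\<sigma> # c))" if "\<sigma> < hd c"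
      using x c that assms(1) unfolding stalk_resolution_sheaf by (blast intro: simplices_Cons[THEN iffD2])
    with lc show ?thesis
      by (simp add: contraction_def subspace_scale subspace_0)
  qed
  moreover have "c \<in> simplices P j \<and> \<sigma> \<le> hd c" if "contraction \<sigma> x c \<noteq> 0" for c
  proof -
    from that have "x (\<sigma> # c) \<noteq> 0" "\<sigma> < hd c"
      by (auto simp: contraction_def split: if_splits)
    with x have "\<sigma> # c \<in> simplices P (Suc j)" by (auto simp: stalk_resolution_sheaf)
    with \<open>\<sigma> < hd c\<close> show ?thesis by (auto simp: simplices_iff)
  qed
  ultimately show ?thesis by (auto simp: stalk_resolution_sheaf)
qed

text \<open>
  Exactly two simplices lie between \<open>c\<close> and \<open>\<sigma> # d\<close>, namely \<open>d\<close> and \<open>\<sigma> # c\<close>, so the vanishing sum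
  for this pair has two terms.  Since all the incidence numbers involved are signs, factors can be
  moved from one side to the other.
\<close>

lemma incidence_exchange:
  assumes \<sigma>: "\<sigma> \<in> P" and d: "d \<in> simplices P (Suc j)" "\<sigma> < hd d" and c: "c <\<^sub>1 d"
  shows "\<epsilon> c d * \<epsilon> c (\<sigma> # c) = - (\<epsilon> d (\<sigma> # d) * \<epsilon> (\<sigma> # c) (\<sigma> # d))"
proof -
  have c': "c \<in> simplices P j" by (rule facet_simplices[OF c d(1)])
  have hd_c: "\<sigma> < hd c"
    using d(2) facet_ends(4)[OF c' d(1) c] by simp
  have \<sigma>c: "\<sigma> # c \<in> simplices P (Suc j)" and \<sigma>d: "\<sigma> # d \<in> simplices P (Suc (Suc j))"
    using \<sigma> d c' hd_c by (simp_all add: simplices_Cons)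
  \<comment> \<open>No third simplex contributes: one that contains \<open>\<sigma>\<close> has the facet \<open>c\<close> only if it is \<open>\<sigma> # c\<close>.\<close>
  have other: "\<epsilon> c e * \<epsilon> e (\<sigma> # d) = 0"
    if "e \<in> simplices P (Suc j)" "e \<noteq> d" "e \<noteq> \<sigma> # c" for e
  proof (rule ccontr)
    assume "\<epsilon> c e * \<epsilon> e (\<sigma> # d) \<noteq> 0"
    then have "c <\<^sub>1 e" "e <\<^sub>1 \<sigma> # d"
      using facet_if_incident[OF c' that(1)] facet_if_incident[OF that(1) \<sigma>d] by auto
    from \<open>e <\<^sub>1 \<sigma> # d\<close> that(2) obtain e' where e: "e = \<sigma> # e'"
      by (auto simp: facet_Cons)
    with \<open>c <\<^sub>1 e\<close> that(3) have "hd c = \<sigma>"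
      by (auto simp: facet_Cons)
    with hd_c show False by simp
  qed
  have "d \<noteq> \<sigma> # c" using d(2) by auto
  have "0 = (\<Sum>e\<in>simplices P (Suc j). \<epsilon> c e * \<epsilon> e (\<sigma> # d))"
    using incidence_sum[OF c'] \<sigma>d simplices_order_complex by metis
  also have "\<dots> = (\<Sum>e\<in>{d, \<sigma> # c}. \<epsilon> c e * \<epsilon> e (\<sigma> # d))"
    using d \<sigma>c other by (intro sum.mono_neutral_right) auto
  also have "\<dots> = \<epsilon> c d * \<epsilon> d (\<sigma> # d) + \<epsilon> c (\<sigma> # c) * \<epsilon> (\<sigma> # c) (\<sigma> # d)"
    using \<open>d \<noteq> \<sigma> # c\<close> by simp
  finally have *: "\<epsilon> c d * \<epsilon> d (\<sigma> # d) = - (\<epsilon> c (\<sigma> # c) * \<epsilon> (\<sigma> # c) (\<sigma> # d))"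
    by (simp add: eq_neg_iff_add_eq_0)
  have sq: "\<epsilon> d (\<sigma> # d) * \<epsilon> d (\<sigma> # d) = 1" "\<epsilon> c (\<sigma> # c) * \<epsilon> c (\<sigma> # c) = 1"
    using c' d(1) \<sigma>c \<sigma>d
    by (auto intro!: incidence_square simplices_order_complex simp: facet_Cons)
  have "\<epsilon> c d * \<epsilon> c (\<sigma> # c)
      = (\<epsilon> c d * \<epsilon> d (\<sigma> # d)) * \<epsilon> d (\<sigma> # d) * \<epsilon> c (\<sigma> # c)"
    using sq(1) by (simp add: mult.assoc)
  also have "\<dots> = - (\<epsilon> d (\<sigma> # d) * \<epsilon> (\<sigma> # c) (\<sigma> # d)) * (\<epsilon> c (\<sigma> # c) * \<epsilon> c (\<sigma> # c))"
    unfolding * by (simp add: mult_ac)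
  finally show ?thesis
    using sq(2) by simp
qed

text \<open>
  On a chain that starts with \<open>\<sigma>\<close> only the base survives in the first term, and the second term is 0.
  On a chain that starts strictly above \<open>\<sigma>\<close> the second term is the value itself plus a sum over the
  facets, which cancels against the first term by the exchange rule for incidence numbers.
\<close>

lemma contracting_homotopy:
  assumes \<sigma>: "\<sigma> \<in> P" and x: "x \<in> stalk (R (Suc j)) \<sigma>"
  shows "\<delta> j \<sigma> (contraction \<sigma> x) + contraction \<sigma> (\<delta> (Suc j) \<sigma> x) = x"
proof
  fix d
  note zero = x[unfolded stalk_resolution_sheaf, THEN conjunct2, rule_format]
  have "\<delta> j \<sigma> (contraction \<sigma> x) d + contraction \<sigma> (\<delta> (Suc j) \<sigma> x) d = x d"
  proof (cases "d \<in> simplices P (Suc j) \<and> \<sigma> \<le> hd d")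
    case False
    then have "x d = 0" using zero by blast
    moreover have "contraction \<sigma> (\<delta> (Suc j) \<sigma> x) d = 0"
    proof (cases "\<sigma> < hd d")
      case True
      with False have "\<sigma> # d \<notin> simplices P (Suc (Suc j))"
        by (auto simp: simplices_iff)
      then show ?thesis by (simp add: contraction_def resolution_map_apply)
    qed (simp add: contraction_def)
    ultimately show ?thesis using False by (auto simp: resolution_map_apply)
  next
    case d: True
    \<comment> \<open>A chain above \<open>\<sigma>\<close> either is a cone with apex \<open>\<sigma>\<close> or is the base of one.\<close>
    show ?thesis
    proof (cases "hd d = \<sigma>")
      case True
      then obtain d' where d': "d = \<sigma> # d'" "d' \<in> simplices P j" "\<sigma> < hd d'"
        using d by (cases d; cases "tl d") (auto simp: simplices_iff)
      have x_stalk: "x d \<in> stalk F (last d')"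
        using x d d' simplex_ends[OF d'(2)] unfolding stalk_resolution_sheaf by auto
      have last_d': "last d' \<in> P" "last d = last d'" using simplex_ends[OF d'(2)] d' by auto
      have d_facet: "d' <\<^sub>1 d" using d'(1) by (simp add: facet_Cons)
      then have sq: "\<epsilon> d' d * \<epsilon> d' d = 1"
        using d d'(2) simplices_order_complex by (intro incidence_square) auto
      \<comment> \<open>The other facets of \<open>d\<close> start with \<open>\<sigma>\<close> as well, where the contraction is 0.\<close>
      have "contraction \<sigma> x c = 0" if "c \<in> simplices P j" "c <\<^sub>1 d" "c \<noteq> d'" for c
        using that d' by (auto simp: contraction_def facet_Cons)
      then have "scale (\<epsilon> c d) (F_map c d (contraction \<sigma> x c)) = 0"
        if "c \<in> simplices P j" "c <\<^sub>1 d" "c \<noteq> d'" for c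
        using that facet_ends[OF that(1) conjunct1[OF d] that(2)] by (simp add: res_zero)
      then have "(\<Sum>c | c \<in> simplices P j \<and> c <\<^sub>1 d.
          scale (\<epsilon> c d) (F_map c d (contraction \<sigma> x c)))
          = (\<Sum>c\<in>{d'}. scale (\<epsilon> c d) (F_map c d (contraction \<sigma> x c)))"
        using d'(2) d_facet by (intro sum.mono_neutral_right) auto
      then have "\<delta> j \<sigma> (contraction \<sigma> x) d
          = (\<Sum>c\<in>{d'}. scale (\<epsilon> c d) (F_map c d (contraction \<sigma> x c)))"
        using d by (simp add: resolution_map_apply)
      also have "\<dots> = scale (\<epsilon> d' d) (F_map d' d (scale (\<epsilon> d' d) (x d)))"
        using d' by (simp add: contraction_def)
      also have "\<dots> = x d"
        using x_stalk last_d' sq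
        by (simp add: res_ident subspace_scale[OF subspace_stalk])
      finally show ?thesis
        using True by (simp add: contraction_def)
    next
      case False
      with d have hd_d: "\<sigma> < hd d" by auto
      let ?S = "\<Sum>c | c <\<^sub>1 d. scale (\<epsilon> d (\<sigma> # d) * \<epsilon> (\<sigma> # c) (\<sigma> # d)) (F_map (\<sigma> # c) d (x (\<sigma> # c)))"
      have "\<sigma> # d \<in> simplices P (Suc (Suc j))"
        using d \<sigma> hd_d by (simp add: simplices_Cons)
      then have sq: "\<epsilon> d (\<sigma> # d) * \<epsilon> d (\<sigma> # d) = 1"
        using d by (intro incidence_square) (auto simp: facet_Cons simplices_order_complex)
      have "contraction \<sigma> (\<delta> (Suc j) \<sigma> x) d = x d + ?S"
        using hd_d d sq resolution_map_cone[OF \<sigma> _ hd_d x]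
        by (simp add: contraction_def scale_right_distrib scale_sum_right)
      moreover have "\<delta> j \<sigma> (contraction \<sigma> x) d = - ?S"
      proof -
        have facets: "{c. c \<in> simplices P j \<and> c <\<^sub>1 d} = {c. c <\<^sub>1 d}"
          using d facet_simplices by blast
        have "scale (\<epsilon> c d) (F_map c d (contraction \<sigma> x c))
            = - scale (\<epsilon> d (\<sigma> # d) * \<epsilon> (\<sigma> # c) (\<sigma> # d)) (F_map (\<sigma> # c) d (x (\<sigma> # c)))"
          if c: "c <\<^sub>1 d" for c
        proof -
          have c': "c \<in> simplices P j" using c d facet_simplices by blast
          note ends = facet_ends[OF c' conjunct1[OF d] c]
          have hd_c: "\<sigma> < hd c" using hd_d ends(4) by simp
          have "c \<noteq> []" using simplex_ends[OF c'] by simp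
          moreover have "\<sigma> # c \<in> simplices P (Suc j)"
            using \<sigma> c' hd_c by (simp add: simplices_Cons)
          ultimately have "x (\<sigma> # c) \<in> stalk F (last c)"
            using x unfolding stalk_resolution_sheaf by auto
          then have "scale (\<epsilon> c d) (F_map c d (contraction \<sigma> x c))
              = scale (\<epsilon> c d * \<epsilon> c (\<sigma> # c)) (F_map c d (x (\<sigma> # c)))"
            using ends hd_c by (simp add: contraction_def res_scale)
          also have "\<dots> = scale (- (\<epsilon> d (\<sigma> # d) * \<epsilon> (\<sigma> # c) (\<sigma> # d))) (F_map c d (x (\<sigma> # c)))"
            by (simp only: incidence_exchange[OF \<sigma> conjunct1[OF d] hd_d c])
          finally show ?thesis
            using \<open>c \<noteq> []\<close> by (simp add: scale_minus_left)
        qed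
        then show ?thesis
          using d by (simp add: resolution_map_apply facets sum_negf)
      qed
      ultimately show ?thesis by simp
    qed
  qed
  then show "(\<delta> j \<sigma> (contraction \<sigma> x) + contraction \<sigma> (\<delta> (Suc j) \<sigma> x)) d = x d"
    by simp
qed

text \<open>
  In degree 0 the correction term is the augmentation of the value at \<open>[\<sigma>]\<close>: the facets of the edge
  \<open>[\<sigma>, \<gamma>]\<close> are \<open>[\<sigma>]\<close> and \<open>[\<gamma>]\<close>, and these have opposite signs.
\<close>

lemma augmented_homotopy:
  assumes \<sigma>: "\<sigma> \<in> P" and x: "x \<in> stalk (R 0) \<sigma>"
  shows "\<alpha> \<sigma> (x [\<sigma>]) + contraction \<sigma> (\<delta> 0 \<sigma> x) = x"
proof
  fix c
  have "\<alpha> \<sigma> (x [\<sigma>]) c + contraction \<sigma> (\<delta> 0 \<sigma> x) c = x c"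
  proof (cases "c \<in> simplices P 0 \<and> \<sigma> \<le> hd c")
    case False
    then have "x c = 0" using x by (auto simp: stalk_resolution_sheaf)
    moreover have "contraction \<sigma> (\<delta> 0 \<sigma> x) c = 0"
    proof (cases "\<sigma> < hd c")
      case True
      with False have "\<sigma> # c \<notin> simplices P (Suc 0)"
        by (auto simp: simplices_iff)
      then show ?thesis by (simp add: contraction_def resolution_map_apply)
    qed (simp add: contraction_def)
    ultimately show ?thesis using False by (auto simp: augmentation_apply)
  next
    case True
    then obtain \<gamma> where c: "c = [\<gamma>]" "\<gamma> \<in> P" "\<sigma> \<le> \<gamma>"
      by (auto simp: simplices_iff length_Suc_conv)
    have "[\<sigma>] \<in> simplices P 0"
      using \<sigma> by (simp add: simplices_iff)
    then have stalk: "x [\<sigma>] \<in> stalk F \<sigma>"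
      using x unfolding stalk_resolution_sheaf by force
    show ?thesis
    proof (cases "\<gamma> = \<sigma>")
      case True
      then show ?thesis
        using c \<sigma> stalk by (simp add: augmentation_apply contraction_def res_ident simplices_iff)
    next
      case False
      with c have less: "\<sigma> < \<gamma>" by simp
      note signs = edge_signs[OF \<sigma> c(2) less]
      have "{c. c <\<^sub>1 [\<gamma>]} = {[]}"
        by (auto simp: facet_Cons)
      then have "\<delta> 0 \<sigma> x [\<sigma>, \<gamma>] = scale (\<epsilon> [\<gamma>] [\<sigma>, \<gamma>]) (x [\<gamma>] - res F \<sigma> \<gamma> (x [\<sigma>]))"
        using resolution_map_cone[OF \<sigma> _ _ x, of "[\<gamma>]"] c less signs(1)
        by (simp add: simplices_iff scale_right_diff_distrib)
      then have "contraction \<sigma> (\<delta> 0 \<sigma> x) [\<gamma>] = x [\<gamma>] - res F \<sigma> \<gamma> (x [\<sigma>])"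
        using less signs(2) by (simp add: contraction_def)
      then show ?thesis
        using c by (simp add: augmentation_apply simplices_iff)
    qed
  qed
  then show "(\<alpha> \<sigma> (x [\<sigma>]) + contraction \<sigma> (\<delta> 0 \<sigma> x)) c = x c"
    by simp
qed

end

section \<open>Exactness and injectivity\<close>

theorem theorem25:
  fixes scale :: "'k::field \<Rightarrow> 'v::ab_group_add \<Rightarrow> 'v"
    and P :: "'p::order set"
    and F :: "('p, 'v) sheaf_data"
    and inc :: "'p list \<Rightarrow> 'p list \<Rightarrow> int"
  assumes "finite P"
    and "sheaf scale P F"
    and "signed_incidence_relation P inc"
    and "nonzero_on_facets P inc"
    and "opposite_on_edges TYPE('k) P inc"
  shows "injective_resolution TYPE('a::ab_group_add) TYPE('b::ab_group_add)
           scale (pointwise_scale scale) P F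
           (resolution_augmentation P F) (resolution_sheaf P F) (resolution_map scale P F inc)"
proof -
  interpret sheaf_with_incidence_numbers scale P F inc
    by (intro sheaf_with_incidence_numbers.intro assms)
  have contraction_zero: "contraction \<sigma> 0 = 0" for \<sigma>
    by (simp add: contraction_def fun_eq_iff)
  have \<alpha>_stalk: "\<alpha> \<pi> v \<in> stalk (R 0) \<pi>" if "\<pi> \<in> P" "v \<in> stalk F \<pi>" for \<pi> v
    using nat_trans_augmentation that unfolding nat_trans_def linear_map_on_def by blast
  have \<delta>_stalk: "\<delta> j \<pi> x \<in> stalk (R (Suc j)) \<pi>" if "\<pi> \<in> P" "x \<in> stalk (R j) \<pi>" for j \<pi> x
    using nat_trans_resolution_map that unfolding nat_trans_def linear_map_on_def by blast
  have "kernel_at F \<alpha> \<pi> = {0}" if \<pi>: "\<pi> \<in> P" for \<pi>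
  proof -
    have "\<alpha> \<pi> 0 = 0"
      using nat_trans_augmentation \<pi> subspace_0[OF subspace_stalk[OF \<pi>]]
      unfolding nat_trans_def by (blast intro: linear_map_on_zero)
    moreover have "v = 0" if "v \<in> stalk F \<pi>" "\<alpha> \<pi> v = 0" for v
    proof -
      \<comment> \<open>\<open>v\<close> is recovered as the component at the vertex \<open>\<pi>\<close>.\<close>
      have "\<alpha> \<pi> v [\<pi>] = v"
        using \<pi> that(1) by (simp add: augmentation_apply simplices_iff res_ident)
      with that(2) show ?thesis by simp
    qed
    ultimately show ?thesis
      using subspace_0[OF subspace_stalk[OF \<pi>]] by (auto simp: kernel_at_def)
  qed
  moreover have "kernel_at (R 0) (\<delta> 0) \<pi> = image_at F \<alpha> \<pi>" if \<pi>: "\<pi> \<in> P" for \<pi>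
  proof
    show "kernel_at (R 0) (\<delta> 0) \<pi> \<subseteq> image_at F \<alpha> \<pi>"
    proof
      fix x assume "x \<in> kernel_at (R 0) (\<delta> 0) \<pi>"
      then have x: "x \<in> stalk (R 0) \<pi>" "\<delta> 0 \<pi> x = 0" by (auto simp: kernel_at_def)
      have "[\<pi>] \<in> simplices P 0" using \<pi> by (simp add: simplices_iff)
      then have "x [\<pi>] \<in> stalk F \<pi>" using x(1) unfolding stalk_resolution_sheaf by force
      moreover have "x = \<alpha> \<pi> (x [\<pi>])"
        using augmented_homotopy[OF \<pi> x(1)] x(2) by (simp add: contraction_zero)
      ultimately show "x \<in> image_at F \<alpha> \<pi>" unfolding image_at_def by blast
    qed
    show "image_at F \<alpha> \<pi> \<subseteq> kernel_at (R 0) (\<delta> 0) \<pi>"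
      using \<alpha>_stalk resolution_map_augmentation \<pi> by (auto simp: image_at_def kernel_at_def)
  qed
  moreover have "kernel_at (R (Suc j)) (\<delta> (Suc j)) \<pi> = image_at (R j) (\<delta> j) \<pi>"
    if \<pi>: "\<pi> \<in> P" for j \<pi>
  proof
    show "kernel_at (R (Suc j)) (\<delta> (Suc j)) \<pi> \<subseteq> image_at (R j) (\<delta> j) \<pi>"
    proof
      fix x assume "x \<in> kernel_at (R (Suc j)) (\<delta> (Suc j)) \<pi>"
      then have x: "x \<in> stalk (R (Suc j)) \<pi>" "\<delta> (Suc j) \<pi> x = 0" by (auto simp: kernel_at_def)
      have "x = \<delta> j \<pi> (contraction \<pi> x)"
        using contracting_homotopy[OF \<pi> x(1)] x(2) by (simp add: contraction_zero)
      then show "x \<in> image_at (R j) (\<delta> j) \<pi>"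
        using contraction_stalk[OF \<pi> x(1)] unfolding image_at_def by blast
    qed
    show "image_at (R j) (\<delta> j) \<pi> \<subseteq> kernel_at (R (Suc j)) (\<delta> (Suc j)) \<pi>"
      using \<delta>_stalk resolution_map_twice \<pi> by (auto simp: image_at_def kernel_at_def)
  qed
  ultimately show ?thesis
    unfolding injective_resolution_def
    using assms(2) injective_resolution_sheaf[where ?'a = 'a and ?'b = 'b] nat_trans_augmentation
      nat_trans_resolution_map by simp
qed

end
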